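(* Every $T_2$ topological space is semi-Hausdorff, and every semi-Hausdorff topological space is $T_1$.
   Context: An open set is regular open if it equals the interior of its closure. A space $X$ is semi-Hausdorff ($sH$) if for each pair of distinct points $x,y\in X$ there exists a regular open set containing $x$ and not containing $y$. *)

theory Defs
  imports "HOL-Analysis.Analysis"
begin

definition regular_openin :: "'a topology \<Rightarrow> 'a set \<Rightarrow> bool"
  where "regular_openin X U \<longleftrightarrow> openin X U \<and> U = X interior_of (X closure_of U)"

definition semi_Hausdorff_space :: "'a topology \<Rightarrow> bool"
  where "semi_Hausdorff_space X \<longleftrightarrow>
    (\<forall>x\<in>topspace X. \<forall>y\<in>topspace X. x \<noteq> y \<longrightarrow> (\<exists>U. regular_openin X U \<and> x \<in> U \<and> y \<notin> U))"

end

theory Submission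
  imports Defs
begin

text \<open>
  The set that separates the points of a Hausdorff space is the interior of the closure of an open
  set. If \<open>U\<close> and \<open>V\<close> are disjoint open neighbourhoods of \<open>x\<close> and \<open>y\<close>, then enlarging \<open>U\<close> to the
  regular open set \<open>int (cl U)\<close> cannot reach \<open>y\<close>, because the open set \<open>V\<close> misses even the closure
  of \<open>U\<close>. That \<open>int (cl U)\<close> is regular open is \<open>regular_openin_interior_of_closure_of\<close>.
  The second implication only forgets regularity: a regular open set is open.
\<close>

text \<open>
  Taking the interior of the closure is idempotent: the interior of a closed set \<open>C\<close> has its closure
  inside \<open>C\<close>, so repeating the operation adds nothing, and it never removes points of an open set.
\<close>
lemma regular_openin_interior_of_closure_of:
  "regular_openin X (X interior_of (X closure_of U))"
proof -
  let ?W = "X interior_of (X closure_of U)"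
  have "X closure_of ?W \<subseteq> X closure_of U"
    by (simp add: closure_of_minimal interior_of_subset)
  then have "X interior_of (X closure_of ?W) \<subseteq> ?W"
    by (rule interior_of_mono)
  moreover have "?W \<subseteq> X interior_of (X closure_of ?W)"
    by (simp add: closure_of_subset interior_of_maximal interior_of_subset_topspace)
  ultimately show ?thesis
    unfolding regular_openin_def
    by (intro conjI openin_interior_of equalityI)
qed

lemma Hausdorff_imp_semi_Hausdorff_space:
  assumes "Hausdorff_space X"
  shows "semi_Hausdorff_space X"
  unfolding semi_Hausdorff_space_def
proof (intro ballI impI)
  fix x y assume "x \<in> topspace X" "y \<in> topspace X" "x \<noteq> y"
  then obtain U V where UV: "openin X U" "openin X V" "x \<in> U" "y \<in> V" "disjnt U V"
    using assms unfolding Hausdorff_space_def by metis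
  have "U \<subseteq> X interior_of (X closure_of U)"
    using UV(1) by (simp add: closure_of_subset interior_of_maximal openin_subset)
  then have x: "x \<in> X interior_of (X closure_of U)"
    using UV(3) by blast
  have "y \<notin> X closure_of U"
    using UV by (auto simp: in_closure_of disjnt_iff)
  then have "y \<notin> X interior_of (X closure_of U)"
    by (meson interior_of_subset subsetD)
  with x show "\<exists>U. regular_openin X U \<and> x \<in> U \<and> y \<notin> U"
    using regular_openin_interior_of_closure_of by blast
qed

lemma regular_openin_imp_openin: "regular_openin X U \<Longrightarrow> openin X U"
  unfolding regular_openin_def by (rule conjunct1)

lemma semi_Hausdorff_imp_t1_space:
  "semi_Hausdorff_space X \<Longrightarrow> t1_space X"
  unfolding semi_Hausdorff_space_def t1_space_def
  by (metis regular_openin_imp_openin)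

theorem theorem45:
  shows "(\<forall>X :: 'a topology. Hausdorff_space X \<longrightarrow> semi_Hausdorff_space X)
       \<and> (\<forall>X :: 'a topology. semi_Hausdorff_space X \<longrightarrow> t1_space X)"
  by (simp add: Hausdorff_imp_semi_Hausdorff_space semi_Hausdorff_imp_t1_space)

end
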